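(* Let $\mathcal{V}$ be a separable real Hilbert space (possibly infinite-dimensional), let $m,N\in\mathbb{N}$, $\boldsymbol{A}\in\mathbb{R}^{m\times N}$ and $\boldsymbol{u}\in\mathcal{V}^m$. Let $0<\tau<2/\|\boldsymbol{A}^*\boldsymbol{A}\|_2$, let $S_\tau:\mathcal{V}^N\to\mathcal{V}^N$ be the forward-backward operator associated with $\boldsymbol{A}$, $\boldsymbol{u}$, $\tau$ (defined in the context), and let $(\boldsymbol{x}^k)_{k\ge 0}$ be the sequence generated by the forward-backward iterations $\boldsymbol{x}^{k+1}=S_\tau(\boldsymbol{x}^k)$ starting from any $\boldsymbol{x}^0\in\mathcal{V}^N$. Then $(\boldsymbol{x}^k)$ converges strongly (i.e., in the norm $\|\cdot\|_{\mathcal{V},2}$) to an element $\boldsymbol{x}^*\in\mathcal{V}^N$ solving $$\min_{\boldsymbol{z}\in\mathcal{V}^N}\ \|\boldsymbol{z}\|_{\mathcal{V},1}+\frac12\|\boldsymbol{A}\boldsymbol{z}-\boldsymbol{u}\|_{\mathcal{V},2}^2 .$$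
   Context: For $n\in\mathbb{N}$, $\boldsymbol{z}=(\boldsymbol{z}_1,\dots,\boldsymbol{z}_n)\in\mathcal{V}^n$ and $q\in\{1,2\}$, $\|\boldsymbol{z}\|_{\mathcal{V},q}:=\big(\sum_{j=1}^n\|\boldsymbol{z}_j\|_{\mathcal{V}}^q\big)^{1/q}$. The space $\mathcal{V}^N$ is regarded as a real Hilbert space with norm $\|\cdot\|_{\mathcal{V},2}$. The real matrix $\boldsymbol{A}=(A_{ij})$ acts on $\mathcal{V}^N$ by $(\boldsymbol{A}\boldsymbol{z})_i=\sum_{j=1}^N A_{ij}\boldsymbol{z}_j\in\mathcal{V}$, $1\le i\le m$; $\boldsymbol{A}^*$ is its adjoint (the transpose matrix, acting from $\mathcal{V}^m$ to $\mathcal{V}^N$ in the same way), and $\|\boldsymbol{A}^*\boldsymbol{A}\|_2$ is the spectral (operator $2$-) norm of $\boldsymbol{A}^*\boldsymbol{A}$. If $\boldsymbol{A}=0$, then $2/\|\boldsymbol{A}^*\boldsymbol{A}\|_2$ is read as $+\infty$. The forward-backward operator is $S_\tau:=J_\tau\circ G_\tau$, where $G_\tau=I-\tau T_2$, $J_\tau=(I+\tau T_1)^{-1}$, $T_1$ is the subdifferential of $\|\cdot\|_{\mathcal{V},1}$ and $T_2$ is the gradient of $\frac12\|\boldsymbol{A}(\cdot)-\boldsymbol{u}\|_{\mathcal{V},2}^2$. Explicitly, $$G_\tau(\boldsymbol{x})=\boldsymbol{x}-\tau\boldsymbol{A}^*(\boldsymbol{A}\boldsymbol{x}-\boldsymbol{u}),$$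 and the $j$-th component of $J_\tau(\boldsymbol{x})$, $1\le j\le N$, is $$\frac{\boldsymbol{x}_j}{\|\boldsymbol{x}_j\|_{\mathcal{V}}}\cdot\max\{\|\boldsymbol{x}_j\|_{\mathcal{V}}-\tau,0\},$$ understood as $0$ when $\boldsymbol{x}_j=0$. *)

theory Defs
  imports "HOL-Analysis.Analysis"
begin

text \<open>
  Elements of the product space of \<open>n\<close> copies of a Hilbert space \<open>'v\<close> have type \<open>'v ^ 'n\<close>.
  The library makes this type a real Hilbert space whose \<open>norm\<close> is the mixed 2-norm (the square
  root of the sum of the squared component norms); only the mixed 1-norm has to be added.
\<close>

definition norm1 :: "'v::real_normed_vector ^ 'n \<Rightarrow> real"
  where "norm1 z = (\<Sum>j\<in>UNIV. norm (z $ j))"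

text \<open>The library's \<open>*v\<close> multiplies scalars of one type, so the action of a real matrix on tuples
  of vectors is a separate operation.\<close>

definition matrix_act :: "real ^ 'n ^ 'm \<Rightarrow> 'v::real_vector ^ 'n \<Rightarrow> 'v ^ 'm"
  where "matrix_act A z = (\<chi> i. \<Sum>j\<in>UNIV. A $ i $ j *\<^sub>R z $ j)"

definition data_fit :: "real ^ 'n ^ 'm \<Rightarrow> 'v::real_inner ^ 'm \<Rightarrow> 'v ^ 'n \<Rightarrow> real"
  where "data_fit A u z = 1 / 2 * (norm (matrix_act A z - u))\<^sup>2"

definition subdifferential :: "('h::real_inner \<Rightarrow> real) \<Rightarrow> 'h \<Rightarrow> 'h set"
  where "subdifferential f x = {g. \<forall>y. f y \<ge> f x + inner g (y - x)}"

definition gradient :: "('h::real_inner \<Rightarrow> real) \<Rightarrow> 'h \<Rightarrow> 'h"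
  where "gradient f x = (THE g. GDERIV f x :> g)"

text \<open>
  \<open>resolvent t T\<close> is the inverse of the set-valued map \<open>I + t T\<close>, read as a function; for the
  subdifferential of the mixed 1-norm it is single-valued and everywhere defined, as shown below.
\<close>

definition resolvent :: "real \<Rightarrow> ('h::real_vector \<Rightarrow> 'h set) \<Rightarrow> 'h \<Rightarrow> 'h"
  where "resolvent t T x = (THE y. \<exists>g\<in>T y. x = y + t *\<^sub>R g)"

definition backward_step :: "real \<Rightarrow> 'v::real_inner ^ 'n \<Rightarrow> 'v ^ 'n"
  where "backward_step t = resolvent t (subdifferential norm1)"

definition forward_step ::
    "real ^ 'n ^ 'm \<Rightarrow> 'v::real_inner ^ 'm \<Rightarrow> real \<Rightarrow> 'v ^ 'n \<Rightarrow> 'v ^ 'n"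
  where "forward_step A u t x = x - t *\<^sub>R gradient (data_fit A u) x"

definition forward_backward ::
    "real ^ 'n ^ 'm \<Rightarrow> 'v::real_inner ^ 'm \<Rightarrow> real \<Rightarrow> 'v ^ 'n \<Rightarrow> 'v ^ 'n"
  where "forward_backward A u t = backward_step t \<circ> forward_step A u t"

definition spectral_norm :: "real ^ 'n ^ 'm \<Rightarrow> real"
  where "spectral_norm M = onorm ((*v) M)"

subsection \<open>Explicit form of the two steps\<close>

lemma linear_matrix_act: "linear (matrix_act A)"
  by (rule linearI)
     (simp_all add: matrix_act_def vec_eq_iff scaleR_add_right sum.distrib scaleR_sum_right mult.commute)

lemma bounded_linear_matrix_act: "bounded_linear (matrix_act A :: 'v::real_inner ^ 'n \<Rightarrow> 'v ^ 'm)"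
proof -
  have comp: "bounded_linear (\<lambda>z::'v ^ 'n. \<Sum>j\<in>UNIV. A $ i $ j *\<^sub>R z $ j)" for i
    by (intro bounded_linear_sum bounded_linear_const_scaleR bounded_linear_vec_nth)
  define B where "B = (\<Sum>i\<in>UNIV. onorm (\<lambda>z::'v ^ 'n. \<Sum>j\<in>UNIV. A $ i $ j *\<^sub>R z $ j))"
  have "norm (matrix_act A z) \<le> norm z * B" for z :: "'v ^ 'n"
  proof -
    have "norm (matrix_act A z) \<le> (\<Sum>i\<in>UNIV. norm (matrix_act A z $ i))"
      unfolding norm_vec_def by (rule L2_set_le_sum) simp
    also have "\<dots> \<le> (\<Sum>i\<in>UNIV. onorm (\<lambda>z::'v ^ 'n. \<Sum>j\<in>UNIV. A $ i $ j *\<^sub>R z $ j) * norm z)"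
      by (rule sum_mono) (simp add: matrix_act_def onorm[OF comp])
    finally show ?thesis by (simp add: B_def sum_distrib_left mult.commute)
  qed
  then show ?thesis
    by (intro bounded_linear_intro[where K = B])
      (simp_all add: linear_add[OF linear_matrix_act] linear_scale[OF linear_matrix_act])
qed

lemma inner_matrix_act:
  "inner (matrix_act A x) y = inner x (matrix_act (transpose A) y)"
proof -
  have "inner (matrix_act A x) y = (\<Sum>i\<in>UNIV. \<Sum>j\<in>UNIV. A $ i $ j * inner (x $ j) (y $ i))"
    by (simp add: inner_vec_def matrix_act_def inner_sum_left)
  also have "\<dots> = (\<Sum>j\<in>UNIV. \<Sum>i\<in>UNIV. A $ i $ j * inner (x $ j) (y $ i))"
    by (rule sum.swap)
  also have "\<dots> = inner x (matrix_act (transpose A) y)"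
    by (simp add: inner_vec_def matrix_act_def inner_sum_right transpose_def)
  finally show ?thesis .
qed

lemma GDERIV_data_fit:
  "GDERIV (data_fit A u) x :> matrix_act (transpose A) (matrix_act A x - u)"
proof -
  note [derivative_intros] = bounded_linear.has_derivative[OF bounded_linear_matrix_act]
  have "data_fit A u = (\<lambda>z. 1 / 2 * inner (matrix_act A z - u) (matrix_act A z - u))"
    by (simp add: data_fit_def fun_eq_iff power2_norm_eq_inner)
  moreover have "((\<lambda>z. 1 / 2 * inner (matrix_act A z - u) (matrix_act A z - u)) has_derivative
      (\<lambda>h. inner h (matrix_act (transpose A) (matrix_act A x - u)))) (at x)"
    by (auto intro!: derivative_eq_intros simp: inner_matrix_act[symmetric] inner_commute fun_eq_iff)
  ultimately show ?thesis by (simp add: gderiv_def)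
qed

lemma gradient_eqI: "gradient f x = g" if "GDERIV f x :> g"
proof -
  have "h = g" if "GDERIV f x :> h" for h
  proof -
    have "(\<lambda>v. inner v h) = (\<lambda>v. inner v g)"
      using \<open>GDERIV f x :> h\<close> \<open>GDERIV f x :> g\<close> unfolding gderiv_def by (rule has_derivative_unique)
    then have "inner (h - g) h = inner (h - g) g" by (rule fun_cong)
    then show ?thesis by (metis eq_iff_diff_eq_0 inner_diff_right inner_eq_zero_iff)
  qed
  with that show ?thesis unfolding gradient_def by (intro the_equality)
qed

lemma forward_step_explicit:
  "forward_step A u t x = x - t *\<^sub>R matrix_act (transpose A) (matrix_act A x - u)"
  by (simp add: forward_step_def gradient_eqI[OF GDERIV_data_fit])

lemma resolvent_subdifferential_unique:
  assumes "t > 0"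
    and "g \<in> subdifferential f y" "x = y + t *\<^sub>R g"
    and "g' \<in> subdifferential f y'" "x = y' + t *\<^sub>R g'"
  shows "y = y'"
proof -
  have "f y' \<ge> f y + inner g (y' - y)" "f y \<ge> f y' + inner g' (y - y')"
    using assms by (auto simp: subdifferential_def)
  then have "inner (g - g') (y' - y) \<le> 0"
    by (simp add: inner_diff_left inner_diff_right)
  then have "inner (t *\<^sub>R (g - g')) (y' - y) \<le> 0"
    using \<open>t > 0\<close> by (simp add: mult_nonneg_nonpos)
  moreover have "t *\<^sub>R (g - g') = y' - y"
    using assms by (simp add: algebra_simps)
  ultimately have "inner (y' - y) (y' - y) \<le> 0" by simp
  then show ?thesis by (metis eq_iff_diff_eq_0 inner_eq_zero_iff inner_ge_zero order_antisym)
qed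

lemma soft_threshold_ineq:
  fixes a y :: "'v::real_inner"
  assumes "t > 0" and p: "p = (max (norm a - t) 0 / norm a) *\<^sub>R a"
  shows "norm y \<ge> norm p + inner ((1 / t) *\<^sub>R (a - p)) (y - p)"
proof (cases "norm a \<le> t")
  case True
  then have "p = 0" using p by simp
  have "inner a y \<le> norm a * norm y" by (rule norm_cauchy_schwarz)
  also have "\<dots> \<le> t * norm y" using True by (simp add: mult_right_mono)
  finally show ?thesis using \<open>p = 0\<close> \<open>t > 0\<close> by (simp add: field_simps)
next
  case False
  then have a: "norm a > t" "norm a > 0" "a \<noteq> 0" using \<open>t > 0\<close> by auto
  have p': "p = ((norm a - t) / norm a) *\<^sub>R a" using p a by simp
  have np: "norm p = norm a - t" using p' a by simp
  have "a - p = (1 - (norm a - t) / norm a) *\<^sub>R a" by (simp add: p' algebra_simps)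
  also have "1 - (norm a - t) / norm a = t / norm a" using a by (simp add: field_simps)
  finally have g: "(1 / t) *\<^sub>R (a - p) = (1 / norm a) *\<^sub>R a" using \<open>t > 0\<close> by simp
  have "inner ((1 / norm a) *\<^sub>R a) p = norm p"
    using a by (simp add: np) (simp add: p' power2_norm_eq_inner[symmetric] power2_eq_square)
  moreover have "inner ((1 / norm a) *\<^sub>R a) y \<le> norm y"
    using norm_cauchy_schwarz[of "(1 / norm a) *\<^sub>R a" y] a by simp
  ultimately show ?thesis unfolding g by (simp add: inner_diff_right)
qed

lemma backward_step_explicit:
  assumes "t > 0"
  shows "backward_step t x = (\<chi> j. (max (norm (x $ j) - t) 0 / norm (x $ j)) *\<^sub>R x $ j)"
proof -
  define p where "p = (\<chi> j. (max (norm (x $ j) - t) 0 / norm (x $ j)) *\<^sub>R x $ j)"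
  have "norm1 y \<ge> norm1 p + inner ((1 / t) *\<^sub>R (x - p)) (y - p)" for y
  proof -
    have "norm1 p + inner ((1 / t) *\<^sub>R (x - p)) (y - p)
        = (\<Sum>j\<in>UNIV. norm (p $ j) + inner ((1 / t) *\<^sub>R (x $ j - p $ j)) (y $ j - p $ j))"
      by (simp add: norm1_def inner_vec_def sum.distrib)
    also have "\<dots> \<le> norm1 y"
      unfolding norm1_def using assms by (intro sum_mono soft_threshold_ineq) (simp_all add: p_def)
    finally show ?thesis .
  qed
  then have "(1 / t) *\<^sub>R (x - p) \<in> subdifferential norm1 p"
    by (simp add: subdifferential_def)
  moreover have "x = p + t *\<^sub>R ((1 / t) *\<^sub>R (x - p))" using assms by simp
  ultimately have "backward_step t x = p"
    unfolding backward_step_def resolvent_def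
    using resolvent_subdifferential_unique[OF assms] by (intro the_equality) blast+
  then show ?thesis by (simp add: p_def)
qed

end

theory Submission
  imports Defs
begin

text \<open>
  The backward step only rescales components, so the iterates stay in the tuples over the
  finite-dimensional span of the components of \<open>u\<close> and \<open>x 0\<close>. The energy decreases along the
  iteration by at least a multiple of the squared step length; being coercive, it keeps the iterates
  bounded, hence in a compact set, and makes the steps tend to \<open>0\<close>. A cluster point is therefore a
  fixed point of the nonexpansive forward-backward operator, that is, a minimizer, and nonexpansiveness
  turns subsequential convergence into convergence.
\<close>

subsection \<open>Finite-dimensional subspaces of an inner product space\<close>

text \<open>Gram-Schmidt followed by normalization; an orthogonal family may contain 0, which is
  dropped before dividing by the norm.\<close>

lemma orthonormal_spanning_set_exists:
  fixes B :: "'a::real_inner set"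
  assumes "finite B"
  obtains E where "finite E" "span E = span B" "\<And>e. e \<in> E \<Longrightarrow> norm e = 1" "pairwise orthogonal E"
proof -
  obtain C where C: "finite C" "span C = span B" "pairwise orthogonal C"
    using basis_orthogonal[OF assms] by blast
  let ?E = "(\<lambda>c. (1 / norm c) *\<^sub>R c) ` (C - {0})"
  have "span ?E = span (C - {0})"
    by (rule span_image_scale) (use C in auto)
  then have "span ?E = span B" using C by simp
  moreover have "pairwise orthogonal ?E"
    using C(3) by (auto simp: pairwise_def orthogonal_def)
  moreover have "norm e = 1" if "e \<in> ?E" for e
    using that by (auto split: if_splits)
  ultimately show thesis using C(1) that[of ?E] by blast
qed

text \<open>Parseval's identity for a finite orthonormal set.\<close>

lemma orthonormal_norm_square:
  fixes E :: "'a::real_inner set"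
  assumes "finite E" "\<And>e. e \<in> E \<Longrightarrow> norm e = 1" "pairwise orthogonal E" "y \<in> span E"
  shows "(norm y)\<^sup>2 = (\<Sum>e\<in>E. (y \<bullet> e)\<^sup>2)"
proof -
  have "y \<bullet> y = (\<Sum>e\<in>E. (y \<bullet> e) *\<^sub>R e) \<bullet> y"
    using arg_cong[OF orthonormal_basis_expand[OF assms(3,2,4,1)], of "\<lambda>v. v \<bullet> y"] by simp
  also have "\<dots> = (\<Sum>e\<in>E. (y \<bullet> e)\<^sup>2)"
    unfolding inner_sum_left by (simp add: power2_eq_square inner_commute)
  finally show ?thesis by (simp add: power2_norm_eq_inner)
qed

lemma compact_sum_sets:
  fixes K :: "'i \<Rightarrow> 'a::real_normed_vector set"
  assumes "finite I" "\<And>i. i \<in> I \<Longrightarrow> compact (K i)"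
  shows "compact {\<Sum>i\<in>I. f i | f. \<forall>i\<in>I. f i \<in> K i}"
  using assms
proof (induction rule: finite_induct)
  case empty
  then show ?case by simp
next
  case (insert k I)
  let ?S = "\<lambda>I. {\<Sum>i\<in>I. f i | f. \<forall>i\<in>I. f i \<in> K i}"
  have "?S (insert k I) = {a + b | a b. a \<in> K k \<and> b \<in> ?S I}" (is "_ = ?T")
  proof
    show "?S (insert k I) \<subseteq> ?T" using insert.hyps by force
    show "?T \<subseteq> ?S (insert k I)"
    proof
      fix y assume "y \<in> ?T"
      then obtain a f where y: "y = a + (\<Sum>i\<in>I. f i)" "a \<in> K k" "\<forall>i\<in>I. f i \<in> K i" by auto
      have "(\<Sum>i\<in>I. (f(k := a)) i) = (\<Sum>i\<in>I. f i)"
        using insert.hyps by (intro sum.cong) auto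
      then show "y \<in> ?S (insert k I)"
        using y insert.hyps by (intro CollectI exI[of _ "f(k := a)"]) auto
    qed
  qed
  moreover have "compact ?T"
    using insert by (intro compact_sums) auto
  ultimately show ?case by (simp only:)
qed

text \<open>A substitute for Heine-Borel inside a possibly infinite-dimensional space: the bounded
  part of the span lies in a finite Minkowski sum of segments along an orthonormal set.\<close>

lemma bounded_span_subset_compact:
  fixes B :: "'a::real_inner set"
  assumes "finite B"
  obtains K where "compact K" "cball 0 r \<inter> span B \<subseteq> K"
proof -
  obtain E where E: "finite E" "span E = span B" "\<And>e. e \<in> E \<Longrightarrow> norm e = 1" "pairwise orthogonal E"
    using orthonormal_spanning_set_exists[OF assms] by metis
  define K where "K = {\<Sum>e\<in>E. f e | f. \<forall>e\<in>E. f e \<in> (\<lambda>a. a *\<^sub>R e) ` {-r..r}}"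
  have "compact K"
    unfolding K_def
    by (intro compact_sum_sets E compact_continuous_image continuous_intros) auto
  moreover have "y \<in> K" if "y \<in> cball 0 r \<inter> span B" for y
  proof -
    \<comment> \<open>Cauchy-Schwarz with \<open>norm e = 1\<close> bounds each coefficient by
      \<open>norm y\<close>, hence by \<open>r\<close>.\<close>
    have "(y \<bullet> e) *\<^sub>R e \<in> (\<lambda>a. a *\<^sub>R e) ` {-r..r}" if "e \<in> E" for e
      using Cauchy_Schwarz_ineq2[of y e] E(3)[OF that] \<open>y \<in> _\<close> by (intro imageI) auto
    moreover have "y = (\<Sum>e\<in>E. (y \<bullet> e) *\<^sub>R e)"
      using orthonormal_basis_expand[OF E(4,3) _ E(1)] that E(2) by fastforce
    ultimately show ?thesis unfolding K_def by blast
  qed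
  ultimately show thesis using that by blast
qed

lemma bounded_components_span_subset_compact:
  fixes B :: "'a::real_inner set"
  assumes "finite B"
  obtains K :: "('a ^ 'n) set" where "compact K" "{z. norm z \<le> r \<and> (\<forall>j. z $ j \<in> span B)} \<subseteq> K"
proof -
  obtain L where L: "compact L" "cball 0 r \<inter> span B \<subseteq> L"
    using bounded_span_subset_compact[OF assms] .
  \<comment> \<open>A tuple is the sum of its components embedded by \<open>axis j\<close>, so
    compactness again comes from a finite sum of compact sets.\<close>
  define K :: "('a ^ 'n) set" where "K = {\<Sum>j\<in>UNIV. f j | f. \<forall>j\<in>UNIV. f j \<in> axis j ` L}"
  have "continuous_on L (axis j :: 'a \<Rightarrow> 'a ^ 'n)" for j
    unfolding axis_def
  proof (rule continuous_on_vec_lambda)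
    show "continuous_on L (\<lambda>w. if i = j then w else 0)" for i
      by (cases "i = j") auto
  qed
  then have "compact K"
    unfolding K_def by (intro compact_sum_sets compact_continuous_image L) auto
  moreover have "z \<in> K" if "norm z \<le> r" "\<forall>j. z $ j \<in> span B" for z
  proof -
    have "z $ j \<in> L" for j
      using that L Finite_Cartesian_Product.norm_nth_le[of z j] by (auto intro: order_trans)
    moreover have "z = (\<Sum>j\<in>UNIV. axis j (z $ j))"
      by (simp add: vec_eq_iff axis_def)
    ultimately show ?thesis unfolding K_def by blast
  qed
  ultimately show thesis using that by blast
qed

subsection \<open>Spectral bounds for the action on tuples of vectors\<close>

lemma spectral_norm_nonneg: "0 \<le> spectral_norm M"
  unfolding spectral_norm_def by (intro onorm_pos_le) simp

text \<open>Bridge to the real case: taking coordinates along \<open>e\<close> commutes with the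
  action, which makes the operator norm of the real matrix applicable.\<close>

lemma matrix_act_component_inner:
  "matrix_act M z $ i \<bullet> e = (M *v (\<chi> j. z $ j \<bullet> e)) $ i"
  by (simp add: matrix_act_def matrix_vector_mult_def inner_sum_left)

lemma matrix_act_mult: "matrix_act (M ** P) z = matrix_act M (matrix_act P z)"
proof -
  have "(\<Sum>j\<in>UNIV. (\<Sum>k\<in>UNIV. M $ i $ k * P $ k $ j) *\<^sub>R z $ j)
      = (\<Sum>k\<in>UNIV. M $ i $ k *\<^sub>R (\<Sum>j\<in>UNIV. P $ k $ j *\<^sub>R z $ j))" for i
    by (simp add: scaleR_sum_left scaleR_sum_right) (rule sum.swap)
  then show ?thesis by (simp add: matrix_act_def matrix_matrix_mult_def vec_eq_iff)
qed

lemma norm_diff_square: "(norm (a - b))\<^sup>2 = (norm a)\<^sup>2 - 2 * (a \<bullet> b) + (norm b)\<^sup>2"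
  by (simp add: power2_norm_eq_inner inner_diff_left inner_diff_right inner_commute)

lemma norm_vec_square: "(norm (z :: 'a::real_inner ^ 'n))\<^sup>2 = (\<Sum>j\<in>UNIV. (norm (z $ j))\<^sup>2)"
  by (simp add: power2_norm_eq_inner inner_vec_def)

text \<open>Expanding along an orthonormal set splits the action into scalar matrix-vector products.\<close>

lemma norm_matrix_act_le:
  fixes M :: "real ^ 'n ^ 'm" and z :: "'v::real_inner ^ 'n"
  shows "norm (matrix_act M z) \<le> spectral_norm M * norm z"
proof -
  \<comment> \<open>Only the components of \<open>z\<close> need expanding, so a finite
    \<open>E\<close> suffices; the components of \<open>matrix_act M z\<close> are combinations of
    them.\<close>
  obtain E where E: "finite E" "span E = span (range (($) z))" "\<And>e. e \<in> E \<Longrightarrow> norm e = 1"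
      "pairwise orthogonal E"
    using orthonormal_spanning_set_exists[of "range (($) z)"] by auto
  have z: "z $ j \<in> span E" for j
    unfolding E by (simp add: span_base)
  have Mz: "matrix_act M z $ i \<in> span E" for i
    using z by (auto simp: matrix_act_def intro!: span_sum span_scale)
  let ?c = "\<lambda>e. \<chi> j. z $ j \<bullet> e"
  have "(norm (matrix_act M z))\<^sup>2 = (\<Sum>i\<in>UNIV. \<Sum>e\<in>E. ((M *v ?c e) $ i)\<^sup>2)"
    using orthonormal_norm_square[OF E(1,3,4) Mz]
    by (simp add: norm_vec_square matrix_act_component_inner)
  also have "\<dots> = (\<Sum>e\<in>E. (norm (M *v ?c e))\<^sup>2)"
    by (subst sum.swap) (simp add: norm_vec_square)
  also have "\<dots> \<le> (\<Sum>e\<in>E. (spectral_norm M * norm (?c e))\<^sup>2)"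
    unfolding spectral_norm_def by (intro sum_mono power_mono onorm) auto
  also have "\<dots> = (spectral_norm M)\<^sup>2 * (\<Sum>e\<in>E. \<Sum>j\<in>UNIV. (z $ j \<bullet> e)\<^sup>2)"
    by (simp add: norm_vec_square power_mult_distrib sum_distrib_left)
  also have "(\<Sum>e\<in>E. \<Sum>j\<in>UNIV. (z $ j \<bullet> e)\<^sup>2) = (norm z)\<^sup>2"
    using orthonormal_norm_square[OF E(1,3,4) z] by (subst sum.swap) (simp add: norm_vec_square)
  finally show ?thesis
    by (intro power2_le_imp_le[OF _ mult_nonneg_nonneg] spectral_norm_nonneg) (simp_all add: power_mult_distrib)
qed

lemma norm_matrix_act_square_le:
  fixes z :: "'v::real_inner ^ 'n"
  shows "(norm (matrix_act A z))\<^sup>2 \<le> spectral_norm (transpose A ** A) * (norm z)\<^sup>2"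
proof -
  have "(norm (matrix_act A z))\<^sup>2 = z \<bullet> matrix_act (transpose A ** A) z"
    by (simp add: power2_norm_eq_inner inner_matrix_act matrix_act_mult)
  also have "\<dots> \<le> norm z * norm (matrix_act (transpose A ** A) z)"
    by (rule norm_cauchy_schwarz)
  also have "\<dots> \<le> norm z * (spectral_norm (transpose A ** A) * norm z)"
    by (intro mult_left_mono norm_matrix_act_le) simp
  finally show ?thesis by (simp add: power2_eq_square mult_ac)
qed

text \<open>The bound has to involve \<open>transpose A ** A\<close>, not the product in the other
  order. Hence the previous estimate is applied to \<open>A\<close> acting on
  \<open>transpose A\<close> acting on \<open>w\<close>, and a common factor is cancelled.\<close>

lemma norm_matrix_act_transpose_square_le:
  fixes w :: "'v::real_inner ^ 'm"
  shows "(norm (matrix_act (transpose A) w))\<^sup>2 \<le> spectral_norm (transpose A ** A) * (norm w)\<^sup>2"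
proof -
  let ?L = "spectral_norm (transpose A ** A)" and ?v = "matrix_act (transpose A) w"
  have "((norm ?v)\<^sup>2)\<^sup>2 = (w \<bullet> matrix_act A ?v)\<^sup>2"
    using inner_matrix_act[of "transpose A" w ?v] by (simp add: power2_norm_eq_inner)
  also have "\<dots> \<le> (norm w)\<^sup>2 * (norm (matrix_act A ?v))\<^sup>2"
    using Cauchy_Schwarz_ineq[of w "matrix_act A ?v"] by (simp add: power2_norm_eq_inner)
  also have "\<dots> \<le> (norm w)\<^sup>2 * (?L * (norm ?v)\<^sup>2)"
    by (intro mult_left_mono norm_matrix_act_square_le) simp
  finally have *: "(norm ?v)\<^sup>2 * (norm ?v)\<^sup>2 \<le> (?L * (norm w)\<^sup>2) * (norm ?v)\<^sup>2"
    by (simp add: power2_eq_square mult_ac)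
  show ?thesis
  proof (cases "?v = 0")
    case True
    then show ?thesis using mult_nonneg_nonneg[OF spectral_norm_nonneg zero_le_power2] by simp
  next
    case False
    then show ?thesis using mult_right_le_imp_le[OF *] by simp
  qed
qed

subsection \<open>The forward and backward steps\<close>

text \<open>The data \<open>u\<close> cancels in the difference. On expanding the square, the cross
  term absorbs the quadratic term in \<tau> precisely because \<tau> times the spectral norm is at
  most 2.\<close>

lemma forward_step_nonexpansive:
  fixes x y :: "'v::real_inner ^ 'n"
  assumes "0 < \<tau>" "\<tau> * spectral_norm (transpose A ** A) \<le> 2"
  shows "norm (forward_step A u \<tau> x - forward_step A u \<tau> y) \<le> norm (x - y)"
proof -
  define d where "d = x - y"
  let ?w = "matrix_act A d" and ?L = "spectral_norm (transpose A ** A)"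
  have lin: "matrix_act M (a - b) = matrix_act M a - matrix_act M b" for M :: "real^'i^'j" and a b :: "'v^'i"
    by (rule linear_diff[OF linear_matrix_act])
  have "forward_step A u \<tau> x - forward_step A u \<tau> y = d - \<tau> *\<^sub>R matrix_act (transpose A) ?w"
    by (simp add: forward_step_explicit d_def lin algebra_simps)
  moreover have "d \<bullet> matrix_act (transpose A) ?w = (norm ?w)\<^sup>2"
    by (simp add: power2_norm_eq_inner inner_matrix_act)
  ultimately have "(norm (forward_step A u \<tau> x - forward_step A u \<tau> y))\<^sup>2
      = (norm d)\<^sup>2 - 2 * \<tau> * (norm ?w)\<^sup>2 + \<tau>\<^sup>2 * (norm (matrix_act (transpose A) ?w))\<^sup>2"
    by (simp only: norm_diff_square) (simp add: power_mult_distrib)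
  also have "\<dots> \<le> (norm d)\<^sup>2 - 2 * \<tau> * (norm ?w)\<^sup>2 + \<tau>\<^sup>2 * (?L * (norm ?w)\<^sup>2)"
    by (intro add_left_mono mult_left_mono norm_matrix_act_transpose_square_le) simp
  also have "\<dots> = (norm d)\<^sup>2 - \<tau> * (2 - \<tau> * ?L) * (norm ?w)\<^sup>2"
    by (simp add: power2_eq_square algebra_simps)
  also have "\<dots> \<le> (norm d)\<^sup>2"
    using assms by simp
  finally show ?thesis by (auto simp: d_def intro: power2_le_imp_le)
qed

text \<open>The residual divided by \<open>t\<close> is a subgradient at the new point. This
  variational inequality underlies nonexpansiveness, descent and minimality below.\<close>

lemma backward_step_subgradient:
  assumes "t > 0"
  shows "norm1 (backward_step t x) + (1 / t) * ((x - backward_step t x) \<bullet> (y - backward_step t x)) \<le> norm1 y"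
proof -
  define p where "p = backward_step t x"
  have p: "p $ j = (max (norm (x $ j) - t) 0 / norm (x $ j)) *\<^sub>R x $ j" for j
    by (simp add: p_def backward_step_explicit[OF assms])
  have "norm1 p + (1 / t) * ((x - p) \<bullet> (y - p))
      = (\<Sum>j\<in>UNIV. norm (p $ j) + (1 / t) *\<^sub>R (x $ j - p $ j) \<bullet> (y $ j - p $ j))"
    by (simp add: norm1_def inner_vec_def sum.distrib sum_distrib_left sum_divide_distrib)
  also have "\<dots> \<le> norm1 y"
    unfolding norm1_def by (intro sum_mono soft_threshold_ineq assms p)
  finally show ?thesis by (simp add: p_def)
qed

lemma backward_step_nonexpansive:
  assumes "t > 0"
  shows "norm (backward_step t x - backward_step t y) \<le> norm (x - y)"
proof -
  let ?p = "backward_step t x" and ?q = "backward_step t y"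
  \<comment> \<open>Monotonicity of the subdifferential: each subgradient inequality is tested at
    the other point and the two are added.\<close>
  have "(1 / t) * ((x - ?p) \<bullet> (?q - ?p)) + (1 / t) * ((y - ?q) \<bullet> (?p - ?q)) \<le> 0"
    using backward_step_subgradient[OF assms, of x ?q] backward_step_subgradient[OF assms, of y ?p]
    by linarith
  then have "(x - ?p) \<bullet> (?q - ?p) + (y - ?q) \<bullet> (?p - ?q) \<le> 0"
    using assms by (simp add: distrib_left[symmetric] mult_le_0_iff divide_le_0_iff add_divide_distrib[symmetric])
  then have "(?p - ?q) \<bullet> (?p - ?q) \<le> (x - y) \<bullet> (?p - ?q)"
    by (simp add: inner_diff_left inner_diff_right inner_commute)
  also have "\<dots> \<le> norm (x - y) * norm (?p - ?q)"
    by (rule norm_cauchy_schwarz)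
  finally have "norm (?p - ?q) * norm (?p - ?q) \<le> norm (x - y) * norm (?p - ?q)"
    by (simp add: power2_norm_eq_inner[symmetric] power2_eq_square)
  then show ?thesis
    by (cases "?p = ?q") auto
qed

lemma forward_backward_nonexpansive:
  assumes "0 < \<tau>" "\<tau> * spectral_norm (transpose A ** A) \<le> 2"
  shows "norm (forward_backward A u \<tau> x - forward_backward A u \<tau> y) \<le> norm (x - y)"
  using backward_step_nonexpansive[OF assms(1)] forward_step_nonexpansive[OF assms]
  by (fastforce simp: forward_backward_def intro: order_trans)

text \<open>Both steps form only real linear combinations of components of \<open>u\<close> and
  \<open>x\<close>; thresholding multiplies each component by a scalar.\<close>

lemma forward_backward_components_in_span:
  assumes "0 < \<tau>" "range (($) u) \<subseteq> span B" "range (($) x) \<subseteq> span B"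
  shows "range (($) (forward_backward A u \<tau> x)) \<subseteq> span B"
  using assms(2,3)
  by (auto simp: forward_backward_def backward_step_explicit[OF assms(1)] forward_step_explicit
      matrix_act_def image_subset_iff intro!: span_scale span_diff span_sum)

section \<open>Energy descent and optimality of fixed points\<close>

lemma data_fit_expansion:
  "data_fit A u y = data_fit A u x + matrix_act (transpose A) (matrix_act A x - u) \<bullet> (y - x)
     + 1 / 2 * (norm (matrix_act A (y - x)))\<^sup>2"
proof -
  \<comment> \<open>The double minus gives the difference the shape that
    \<open>norm_diff_square\<close> expands.\<close>
  have "matrix_act A y - u = (matrix_act A x - u) - (- matrix_act A (y - x))"
    by (simp add: linear_diff[OF linear_matrix_act])
  then have "(norm (matrix_act A y - u))\<^sup>2 = (norm (matrix_act A x - u))\<^sup>2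
      + 2 * ((matrix_act A x - u) \<bullet> matrix_act A (y - x)) + (norm (matrix_act A (y - x)))\<^sup>2"
    by (simp only: norm_diff_square) simp
  moreover have "(matrix_act A x - u) \<bullet> matrix_act A (y - x)
      = matrix_act (transpose A) (matrix_act A x - u) \<bullet> (y - x)"
    by (simp add: inner_commute[of _ "y - x"] inner_commute[of _ "matrix_act A (y - x)"] inner_matrix_act)
  ultimately show ?thesis by (simp add: data_fit_def)
qed

text \<open>Testing the subgradient inequality at the old point gains \<open>1 / \<tau>\<close>,
  twice what comparing proximal objective values gives; the quadratic remainder of the data term
  costs half the spectral norm. The net factor is thus positive on the whole admissible range of
  \<tau>.\<close>

lemma forward_backward_descent:
  fixes A :: "real ^ 'n ^ 'm" and u :: "'v::real_inner ^ 'm" and x :: "'v ^ 'n"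
  assumes "0 < \<tau>"
  defines "F \<equiv> \<lambda>z. norm1 z + data_fit A u z" and "p \<equiv> forward_backward A u \<tau> x"
  shows "F p + (1 / \<tau> - spectral_norm (transpose A ** A) / 2) * (norm (p - x))\<^sup>2 \<le> F x"
proof -
  let ?g = "matrix_act (transpose A) (matrix_act A x - u)"
  let ?L = "spectral_norm (transpose A ** A)"
  have "norm1 p + (1 / \<tau>) * ((x - \<tau> *\<^sub>R ?g - p) \<bullet> (x - p)) \<le> norm1 x"
    using backward_step_subgradient[OF assms(1), of "forward_step A u \<tau> x" x]
    by (simp add: p_def forward_backward_def forward_step_explicit)
  moreover have "(1 / \<tau>) * ((x - \<tau> *\<^sub>R ?g - p) \<bullet> (x - p)) = (1 / \<tau>) * (norm (p - x))\<^sup>2 + ?g \<bullet> (p - x)"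
  proof -
    have "(- d - \<tau> *\<^sub>R ?g) \<bullet> (- d) = (norm d)\<^sup>2 + \<tau> * (?g \<bullet> d)" for d
      by (simp add: power2_norm_eq_inner inner_diff_left)
    from this[of "p - x"] have "(x - \<tau> *\<^sub>R ?g - p) \<bullet> (x - p) = (norm (p - x))\<^sup>2 + \<tau> * (?g \<bullet> (p - x))"
      by (simp add: diff_diff_eq add.commute)
    then show ?thesis
      using assms(1) by (simp add: distrib_left)
  qed
  moreover have "1 / 2 * (norm (matrix_act A (p - x)))\<^sup>2 \<le> ?L / 2 * (norm (p - x))\<^sup>2"
    using norm_matrix_act_square_le[of A "p - x"] by simp
  ultimately show ?thesis
    using data_fit_expansion[of A u p x] by (simp add: F_def left_diff_distrib)
qed

text \<open>At a fixed point the negative gradient of the data term is a subgradient of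
  \<open>norm1\<close>, and the remainder of the data term is nonnegative.\<close>

lemma forward_backward_fixed_point_minimal:
  assumes "0 < \<tau>" "forward_backward A u \<tau> x = x"
  shows "norm1 x + data_fit A u x \<le> norm1 y + data_fit A u y"
proof -
  let ?g = "matrix_act (transpose A) (matrix_act A x - u)"
  have "norm1 x + (1 / \<tau>) * ((x - \<tau> *\<^sub>R ?g - x) \<bullet> (y - x)) \<le> norm1 y"
    using backward_step_subgradient[OF assms(1), of "forward_step A u \<tau> x" y] assms(2)
    by (simp add: forward_backward_def forward_step_explicit)
  then have "norm1 x - ?g \<bullet> (y - x) \<le> norm1 y"
    using assms(1) by simp
  then show ?thesis
    using data_fit_expansion[of A u y x] zero_le_power2[of "norm (matrix_act A (y - x))"] by linarith
qed

lemma norm_le_norm1: "norm z \<le> norm1 z"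
  unfolding norm1_def norm_vec_def by (rule L2_set_le_sum) simp

subsection \<open>Convergence of the iteration\<close>

lemma nonexpansive_iteration_tendsto:
  fixes x :: "nat \<Rightarrow> 'a::real_normed_vector"
  assumes nonexp: "\<And>a b. norm (S a - S b) \<le> norm (a - b)"
    and iter: "\<And>k. x (Suc k) = S (x k)"
    and K: "compact K" "\<And>k. x k \<in> K"
    and steps: "(\<lambda>k. x (Suc k) - x k) \<longlonglongrightarrow> 0"
  obtains p where "x \<longlonglongrightarrow> p" "S p = p"
proof -
  obtain p r where r: "strict_mono (r :: nat \<Rightarrow> nat)" "(x \<circ> r) \<longlonglongrightarrow> p"
    using K unfolding compact_def by metis
  have xr: "(\<lambda>k. norm (x (r k) - p)) \<longlonglongrightarrow> 0"
    using r(2) by (simp add: tendsto_norm_zero_iff LIM_zero_iff o_def)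
  have sr: "(\<lambda>k. norm (x (Suc (r k)) - x (r k))) \<longlonglongrightarrow> 0"
    using LIMSEQ_subseq_LIMSEQ[OF steps r(1)] by (simp add: tendsto_norm_zero_iff o_def)
  \<comment> \<open>The distance to \<open>p\<close> is counted twice: once directly and once after
    applying \<open>S\<close>.\<close>
  have "norm (S p - p) \<le> 2 * norm (x (r k) - p) + norm (x (Suc (r k)) - x (r k))" for k
  proof -
    have "norm (S p - p) \<le> norm (S p - S (x (r k))) + norm (S (x (r k)) - x (r k)) + norm (x (r k) - p)"
      by norm
    moreover have "norm (S p - S (x (r k))) \<le> norm (x (r k) - p)"
      using nonexp[of p "x (r k)"] by (simp add: norm_minus_commute)
    ultimately show ?thesis by (simp add: iter)
  qed
  moreover have "(\<lambda>k. 2 * norm (x (r k) - p) + norm (x (Suc (r k)) - x (r k))) \<longlonglongrightarrow> 2 * 0 + 0"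
    by (intro tendsto_intros xr sr)
  ultimately have "norm (S p - p) \<le> 2 * 0 + 0"
    by (intro LIMSEQ_le_const) auto
  then have fixed: "S p = p" by simp
  \<comment> \<open>Distances to a fixed point never increase, so their limit can be read off along
    the subsequence.\<close>
  have "decseq (\<lambda>k. norm (x k - p))"
    using nonexp[of _ p] by (intro decseq_SucI) (simp add: iter fixed)
  then obtain l where l: "(\<lambda>k. norm (x k - p)) \<longlonglongrightarrow> l"
    using decseq_convergent[of "\<lambda>k. norm (x k - p)" 0] by auto
  have "l = 0"
    using LIMSEQ_subseq_LIMSEQ[OF l r(1)] xr by (auto simp: o_def intro: LIMSEQ_unique)
  then have "x \<longlonglongrightarrow> p"
    using l by (simp add: tendsto_norm_zero_iff LIM_zero_iff)
  with fixed show thesis using that by blast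
qed

theorem theorem2:
  fixes A :: "real ^ 'n ^ 'm"
    and u :: "'v::{real_inner, banach} ^ 'm"
    and \<tau> :: real
    and x :: "nat \<Rightarrow> 'v ^ 'n"
  assumes "separable_space (euclidean :: 'v topology)"
    and "0 < \<tau>"
    and "A \<noteq> 0 \<longrightarrow> \<tau> < 2 / spectral_norm (transpose A ** A)"
    and "\<And>k. x (Suc k) = forward_backward A u \<tau> (x k)"
  shows "\<exists>xstar. x \<longlonglongrightarrow> xstar \<and>
    is_arg_min (\<lambda>z. norm1 z + 1 / 2 * (norm (matrix_act A z - u))\<^sup>2) (\<lambda>z. True) xstar"
proof -
  let ?L = "spectral_norm (transpose A ** A)"
  define F where "F z = norm1 z + data_fit A u z" for z
  define c where "c = 1 / \<tau> - ?L / 2"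
  \<comment> \<open>The product form treats both cases at once; for \<open>A = 0\<close> it holds
    for every \<tau>.\<close>
  have tL: "\<tau> * ?L < 2"
  proof (cases "A = 0")
    case True
    then have "transpose A ** A = 0"
      by (simp add: matrix_matrix_mult_def vec_eq_iff)
    moreover have "(*v) (0 :: real ^ 'n ^ 'n) = (\<lambda>_. 0)" by auto
    ultimately show ?thesis by (simp add: spectral_norm_def onorm_zero)
  next
    case False
    then have "\<tau> < 2 / ?L" using assms(3) by blast
    \<comment> \<open>A vanishing norm is excluded since \<open>2 / 0 = 0\<close> would contradict
      \<open>0 < \<tau>\<close>.\<close>
    moreover from this have "?L > 0"
      using spectral_norm_nonneg[of "transpose A ** A"] assms(2) by (cases "?L = 0") auto
    ultimately show ?thesis by (simp add: field_simps)
  qed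
  then have "c > 0" using assms(2) by (simp add: c_def field_simps)
  have descent: "F (x (Suc k)) + c * (norm (x (Suc k) - x k))\<^sup>2 \<le> F (x k)" for k
    using forward_backward_descent[OF assms(2), of A u "x k"] by (simp add: F_def c_def assms(4))
  have Fnorm: "norm z \<le> F z" for z
    using norm_le_norm1[of z] by (simp add: F_def data_fit_def add_increasing2)
  have "decseq (\<lambda>k. F (x k))"
    using descent \<open>c > 0\<close> by (intro decseq_SucI) (smt (verit) mult_nonneg_nonneg zero_le_power2)
  moreover have "0 \<le> F (x k)" for k using Fnorm[of "x k"] norm_ge_zero order_trans by blast
  ultimately obtain l where l: "(\<lambda>k. F (x k)) \<longlonglongrightarrow> l"
    using decseq_convergent[of "\<lambda>k. F (x k)" 0] by metis
  \<comment> \<open>Descent bounds the squared step by an energy drop over \<open>c\<close>, and the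
    drops vanish because the energies converge.\<close>
  have "(\<lambda>k. (norm (x (Suc k) - x k))\<^sup>2) \<longlonglongrightarrow> 0"
  proof (rule tendsto_sandwich[OF _ _ tendsto_const])
    show "(\<lambda>k. (F (x k) - F (x (Suc k))) / c) \<longlonglongrightarrow> 0"
      using tendsto_divide[OF tendsto_diff[OF l LIMSEQ_Suc[OF l]] tendsto_const[of c]] \<open>c > 0\<close> by simp
    show "\<forall>\<^sub>F k in sequentially. (norm (x (Suc k) - x k))\<^sup>2 \<le> (F (x k) - F (x (Suc k))) / c"
      using descent \<open>c > 0\<close> by (intro always_eventually allI) (simp add: field_simps)
  qed simp
  then have steps: "(\<lambda>k. x (Suc k) - x k) \<longlonglongrightarrow> 0"
    by (simp add: tendsto_norm_zero_iff)
  \<comment> \<open>Finitely many vectors whose span contains the components of every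
    iterate.\<close>
  define B where "B = range (($) u) \<union> range (($) (x 0))"
  have "range (($) (x k)) \<subseteq> span B" for k
  proof (induction k)
    case 0
    show ?case by (auto simp: B_def intro: span_base)
  next
    case (Suc k)
    show ?case
      unfolding assms(4) by (intro forward_backward_components_in_span assms Suc)
        (auto simp: B_def intro: span_base)
  qed
  moreover have "norm (x k) \<le> F (x 0)" for k
    using Fnorm[of "x k"] \<open>decseq (\<lambda>k. F (x k))\<close> by (auto simp: decseq_def intro: order_trans)
  moreover obtain K :: "('v ^ 'n) set"
    where "compact K" "{z. norm z \<le> F (x 0) \<and> (\<forall>j. z $ j \<in> span B)} \<subseteq> K"
    using bounded_components_span_subset_compact[of B] by (auto simp: B_def)
  ultimately have "compact K" "x k \<in> K" for k by (auto simp: subset_eq)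
  moreover have "norm (forward_backward A u \<tau> a - forward_backward A u \<tau> b) \<le> norm (a - b)" for a b
    using tL by (intro forward_backward_nonexpansive assms(2)) simp
  ultimately obtain p where "x \<longlonglongrightarrow> p" "forward_backward A u \<tau> p = p"
    using nonexpansive_iteration_tendsto[OF _ assms(4) _ _ steps] by metis
  then show ?thesis
    using forward_backward_fixed_point_minimal[OF assms(2), of A u p]
    by (intro exI[of _ p]) (auto simp: is_arg_min_linorder data_fit_def)
qed

end
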